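(* Let $\omega$ be a positive integer. For every deterministic online algorithm $A$ for call control with $\omega$ frequencies in triangle-free cellular networks, there exist a triangle-free cellular network and a request sequence $\sigma$ such that $O(\sigma)\ge \frac53 A(\sigma)$. Hence the competitive ratio of any deterministic online algorithm for call control in triangle-free cellular networks is at least $5/3$.
   Context: Consider the infinite tiling of the plane by regular hexagons (cells), two cells being neighbors if they share an edge. A triangle-free cellular network is a set of cells, with the induced neighbor relation, containing no three mutually neighboring cells. Call control: there are $\omega$ frequencies $\{1,\dots,\omega\}$; a request sequence $\sigma$ is a finite sequence of cells of the network at which call requests arrive one by one; an online algorithm, not knowing future requests, must immediately reject each request or accept it by assigning a frequency, such that two accepted calls in the same cell or in neighboring cells never get the same frequency; calls never terminate and frequencies are never changed. $A(\sigma)$ is the number of requests accepted by $A$, and $O(\sigma)$ is the maximum number of requests of $\sigma$ that can be simultaneously accepted by a conflict-free assignment. *)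

theory Defs
  imports Complex_Main "HOL-Library.Extended_Real"
begin

text \<open>
  Axial coordinates: \<open>(a, b)\<close> is the regular hexagon centred at \<open>a * u + b * v\<close>, where
  \<open>u\<close> and \<open>v\<close> are vectors of equal length at an angle of 60 degrees.  The six hexagons sharing
  an edge with it are those centred at distance \<open>|u|\<close>, i.e. displaced by
  \<open>u\<close>, \<open>v\<close>, \<open>v - u\<close> or their negatives.
\<close>

type_synonym cell = "int \<times> int"

definition neighbor :: "cell \<Rightarrow> cell \<Rightarrow> bool" where
  "neighbor x y \<longleftrightarrow>
     (fst y - fst x, snd y - snd x) \<in> {(1, 0), (0, 1), (-1, 1), (-1, 0), (0, -1), (1, -1)}"

text \<open>A cellular network is given by its set of cells; its neighbor relation is the induced one.\<close>

definition triangle_free :: "cell set \<Rightarrow> bool" where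
  "triangle_free V \<longleftrightarrow>
     \<not> (\<exists>x\<in>V. \<exists>y\<in>V. \<exists>z\<in>V. neighbor x y \<and> neighbor y z \<and> neighbor x z)"

text \<open>
  The \<open>i\<close>-th request of \<open>\<sigma>\<close> is a call in cell \<open>\<sigma> ! i\<close>.  An assignment maps request indices
  to \<open>Some c\<close> (accepted with frequency \<open>c\<close>) or \<open>None\<close> (rejected); only its values at indices
  below \<open>length \<sigma>\<close> matter.
\<close>

type_synonym assignment = "nat \<Rightarrow> nat option"

definition conflict_free :: "nat \<Rightarrow> cell list \<Rightarrow> assignment \<Rightarrow> bool" where
  "conflict_free \<omega> \<sigma> f \<longleftrightarrow>
     (\<forall>i<length \<sigma>. \<forall>c. f i = Some c \<longrightarrow> c \<in> {1..\<omega>}) \<and>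
     (\<forall>i<length \<sigma>. \<forall>j<length \<sigma>. \<forall>c.
        i \<noteq> j \<and> (\<sigma> ! i = \<sigma> ! j \<or> neighbor (\<sigma> ! i) (\<sigma> ! j)) \<longrightarrow>
        \<not> (f i = Some c \<and> f j = Some c))"

definition num_accepted :: "cell list \<Rightarrow> assignment \<Rightarrow> nat" where
  "num_accepted \<sigma> f = card {i. i < length \<sigma> \<and> f i \<noteq> None}"

definition opt :: "nat \<Rightarrow> cell list \<Rightarrow> nat" where
  "opt \<omega> \<sigma> = Max {num_accepted \<sigma> f | f. conflict_free \<omega> \<sigma> f}"

lemma opt_set_finite: "finite {num_accepted \<sigma> f | f. conflict_free \<omega> \<sigma> f}"
proof (rule finite_subset)
  have "num_accepted \<sigma> f \<le> length \<sigma>" for f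
    using card_mono[of "{..<length \<sigma>}" "{i. i < length \<sigma> \<and> f i \<noteq> None}"]
    by (auto simp: num_accepted_def)
  then show "{num_accepted \<sigma> f | f. conflict_free \<omega> \<sigma> f} \<subseteq> {..length \<sigma>}" by auto
qed simp

lemma opt_set_nonempty: "{num_accepted \<sigma> f | f. conflict_free \<omega> \<sigma> f} \<noteq> {}"
proof -
  have "conflict_free \<omega> \<sigma> (\<lambda>_. None)" by (simp add: conflict_free_def)
  then show ?thesis by blast
qed

text \<open>
  A deterministic online algorithm decides on a request from the network, the list of all earlier
  requests, and the requested cell.  Its own earlier decisions are functions of these data and need
  not be passed.  It may know the whole network in advance.
\<close>

type_synonym strategy = "cell set \<Rightarrow> cell list \<Rightarrow> cell \<Rightarrow> nat option"

definition run :: "strategy \<Rightarrow> cell set \<Rightarrow> cell list \<Rightarrow> assignment" where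
  "run A V \<sigma> = (\<lambda>i. A V (take i \<sigma>) (\<sigma> ! i))"

definition online_algorithm :: "nat \<Rightarrow> strategy \<Rightarrow> bool" where
  "online_algorithm \<omega> A \<longleftrightarrow>
     (\<forall>V \<sigma>. triangle_free V \<and> set \<sigma> \<subseteq> V \<longrightarrow> conflict_free \<omega> \<sigma> (run A V \<sigma>))"

definition alg :: "strategy \<Rightarrow> cell set \<Rightarrow> cell list \<Rightarrow> nat" where
  "alg A V \<sigma> = num_accepted \<sigma> (run A V \<sigma>)"

text \<open>
  The supremum of the ratio of the optimum to the algorithm's value.  For nonempty \<open>\<sigma>\<close> and
  \<open>\<omega> > 0\<close> the optimum is positive, so the ratio is \<open>\<infinity>\<close> when the algorithm accepts nothing.
\<close>

definition competitive_ratio :: "nat \<Rightarrow> strategy \<Rightarrow> ereal" where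
  "competitive_ratio \<omega> A =
     (SUP (V, \<sigma>) \<in> {(V, \<sigma>). triangle_free V \<and> set \<sigma> \<subseteq> V \<and> \<sigma> \<noteq> []}.
        ereal (real (opt \<omega> \<sigma>)) / ereal (real (alg A V \<sigma>)))"

end

theory Submission
  imports Defs
begin

text \<open>
  Take a star: a centre with three pairwise non-adjacent neighbors.  Request \<open>\<omega>\<close> calls in the
  centre and let \<open>x\<close> be the number of them that the algorithm accepts.  If \<open>5 x \<le> 3 \<omega>\<close>, stop: the
  optimum is \<open>\<omega>\<close>.  Otherwise request \<open>\<omega>\<close> calls in each leaf: the optimum is at least \<open>3 \<omega>\<close>, while
  only \<open>\<omega> - x\<close> frequencies are left in each leaf, so the algorithm accepts at most
  \<open>x + 3 (\<omega> - x) = 3 \<omega> - 2 x \<le> 9 \<omega> / 5\<close> calls.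
\<close>

lemma num_accepted_le_opt:
  assumes "conflict_free \<omega> \<sigma> f"
  shows "num_accepted \<sigma> f \<le> opt \<omega> \<sigma>"
  unfolding opt_def by (rule Max_ge[OF opt_set_finite]) (use assms in blast)

lemma opt_pos:
  assumes "\<omega> > 0" and "\<sigma> \<noteq> []"
  shows "opt \<omega> \<sigma> > 0"
proof -
  define f :: assignment where "f = (\<lambda>i. if i = 0 then Some 1 else None)"
  have "conflict_free \<omega> \<sigma> f"
    using assms by (auto simp: conflict_free_def f_def)
  moreover have "{i. i < length \<sigma> \<and> f i \<noteq> None} = {0}"
    using assms by (auto simp: f_def)
  then have "num_accepted \<sigma> f = 1" by (simp add: num_accepted_def)
  ultimately show ?thesis using num_accepted_le_opt[of \<omega> \<sigma> f] by simp
qed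

lemma competitive_ratio_geI:
  assumes "triangle_free V" "set \<sigma> \<subseteq> V" "\<sigma> \<noteq> []" "\<omega> > 0"
    and le: "r * real (alg A V \<sigma>) \<le> real (opt \<omega> \<sigma>)"
  shows "ereal r \<le> competitive_ratio \<omega> A"
proof -
  have "ereal r \<le> ereal (real (opt \<omega> \<sigma>)) / ereal (real (alg A V \<sigma>))"
  \<comment> \<open>Division by zero in \<open>ereal\<close> gives infinity only for a nonzero
    numerator, since 0 / 0 = 0. Positivity of the optimum is what settles this case.\<close>
  proof (cases "alg A V \<sigma> = 0")
    case True
    then show ?thesis
      using opt_pos[OF \<open>\<omega> > 0\<close> \<open>\<sigma> \<noteq> []\<close>]
      by (simp add: divide_ereal_def zero_ereal_def[symmetric])
  next
    case False
    then show ?thesis using le by (simp add: pos_le_divide_eq)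
  qed
  also have "\<dots> \<le> competitive_ratio \<omega> A"
    unfolding competitive_ratio_def using assms(1-3)
    by (intro SUP_upper2[where i = "(V, \<sigma>)"]) auto
  finally show ?thesis .
qed

text \<open>Any two requests in \<open>S\<close> conflict, so the accepted ones carry distinct
  frequencies, and \<open>f\<close> injects them into the \<omega> available ones.\<close>

lemma card_accepted_clique_le:
  assumes cf: "conflict_free \<omega> \<sigma> f"
    and S: "S \<subseteq> {..<length \<sigma>}"
    and clique: "\<And>i j. i \<in> S \<Longrightarrow> j \<in> S \<Longrightarrow> i \<noteq> j \<Longrightarrow> \<sigma> ! i = \<sigma> ! j \<or> neighbor (\<sigma> ! i) (\<sigma> ! j)"
  shows "card {i \<in> S. f i \<noteq> None} \<le> \<omega>"
proof -
  let ?S = "{i \<in> S. f i \<noteq> None}"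
  have "inj_on (the \<circ> f) ?S"
  proof (rule inj_onI, rule ccontr)
    fix i j assume ij: "i \<in> ?S" "j \<in> ?S" "(the \<circ> f) i = (the \<circ> f) j" "i \<noteq> j"
    then obtain c where "f i = Some c" "f j = Some c" by auto
    moreover have "i < length \<sigma>" "j < length \<sigma>" using ij S by auto
    moreover have "\<sigma> ! i = \<sigma> ! j \<or> neighbor (\<sigma> ! i) (\<sigma> ! j)" using clique ij by simp
    ultimately show False using cf \<open>i \<noteq> j\<close> unfolding conflict_free_def by blast
  qed
  moreover have "(the \<circ> f) ` ?S \<subseteq> {1..\<omega>}"
  proof (rule image_subsetI)
    fix i assume "i \<in> ?S"
    then obtain c where "i < length \<sigma>" "f i = Some c" using S by auto
    then show "(the \<circ> f) i \<in> {1..\<omega>}" using cf by (auto simp: conflict_free_def)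
  qed
  ultimately show ?thesis
    using card_inj_on_le[of "the \<circ> f" ?S "{1..\<omega>}"] by simp
qed

text \<open>Indexing by division makes request \<open>i\<close> the call number
  \<open>i mod \<omega>\<close> in the cell at position \<open>i div \<omega>\<close>, so blocks and
  frequencies can be handled by arithmetic on indices.\<close>

definition flood :: "nat \<Rightarrow> cell list \<Rightarrow> cell list" where
  "flood \<omega> cs = map (\<lambda>i. cs ! (i div \<omega>)) [0..<length cs * \<omega>]"

lemma length_flood [simp]: "length (flood \<omega> cs) = length cs * \<omega>"
  by (simp add: flood_def)

lemma nth_flood: "i < length cs * \<omega> \<Longrightarrow> flood \<omega> cs ! i = cs ! (i div \<omega>)"
  by (simp add: flood_def)

lemma set_flood: "set (flood \<omega> cs) \<subseteq> set cs"
  by (auto simp: flood_def less_mult_imp_div_less)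

lemma take_flood:
  assumes "k \<le> length cs"
  shows "take (k * \<omega>) (flood \<omega> cs) = flood \<omega> (take k cs)"
proof (rule nth_equalityI)
  show "length (take (k * \<omega>) (flood \<omega> cs)) = length (flood \<omega> (take k cs))"
    using assms by simp
next
  fix i assume "i < length (take (k * \<omega>) (flood \<omega> cs))"
  then have i: "i < k * \<omega>" "i < length cs * \<omega>" by auto
  then show "take (k * \<omega>) (flood \<omega> cs) ! i = flood \<omega> (take k cs) ! i"
    using assms by (simp add: nth_flood less_mult_imp_div_less)
qed

text \<open>Reject the first \<open>m\<close> blocks and accept everything after them: the remaining
  cells are pairwise non-adjacent, so each can use all \<omega> frequencies.\<close>

lemma opt_flood_ge:
  assumes "m \<le> length cs" and dist: "distinct cs"
    and indep: "\<forall>x\<in>set (drop m cs). \<forall>y\<in>set (drop m cs). \<not> neighbor x y"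
  shows "(length cs - m) * \<omega> \<le> opt \<omega> (flood \<omega> cs)"
proof -
  let ?\<sigma> = "flood \<omega> cs"
  define f :: assignment where "f = (\<lambda>i. if i < m * \<omega> then None else Some (Suc (i mod \<omega>)))"
  have "conflict_free \<omega> ?\<sigma> f"
    unfolding conflict_free_def
  proof (intro conjI allI impI notI)
    fix i c assume "i < length ?\<sigma>" "f i = Some c"
    \<comment> \<open>For \<omega> = 0 the remainder \<open>i mod \<omega>\<close> is
      \<open>i\<close> and has no useful bound, but then there are no requests at all.\<close>
    then show "c \<in> {1..\<omega>}"
      by (cases "\<omega> = 0") (auto simp: f_def Suc_le_eq split: if_splits)
  next
    fix i j c
    assume i: "i < length ?\<sigma>" and j: "j < length ?\<sigma>"
      and conf: "i \<noteq> j \<and> (?\<sigma> ! i = ?\<sigma> ! j \<or> neighbor (?\<sigma> ! i) (?\<sigma> ! j))"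
      and fij: "f i = Some c \<and> f j = Some c"
    have "\<omega> > 0" using i by (cases "\<omega> = 0") auto
    have bounds: "i div \<omega> < length cs" "j div \<omega> < length cs"
      using i j by (auto intro: less_mult_imp_div_less)
    have late: "m \<le> i div \<omega>" "m \<le> j div \<omega>" and mod: "i mod \<omega> = j mod \<omega>"
      using fij \<open>\<omega> > 0\<close> by (auto simp: f_def less_eq_div_iff_mult_less_eq split: if_splits)
    \<comment> \<open>Equal frequencies mean equal remainders, so different requests must lie in
      different blocks, hence in different cells.\<close>
    have "i div \<omega> \<noteq> j div \<omega>" using conf mod by (metis div_mult_mod_eq)
    then have "?\<sigma> ! i \<noteq> ?\<sigma> ! j"
      using i j bounds dist by (simp add: nth_flood nth_eq_iff_index_eq)
    moreover have "cs ! k \<in> set (drop m cs)" if "m \<le> k" "k < length cs" for k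
      using that nth_mem[of "k - m" "drop m cs"] by simp
    then have "\<not> neighbor (?\<sigma> ! i) (?\<sigma> ! j)"
      using i j bounds late indep by (simp add: nth_flood)
    ultimately show False using conf by blast
  qed
  moreover have "{i. i < length ?\<sigma> \<and> f i \<noteq> None} = {m * \<omega>..<length cs * \<omega>}"
    by (auto simp: f_def split: if_splits)
  then have "num_accepted ?\<sigma> f = (length cs - m) * \<omega>"
    by (simp add: num_accepted_def diff_mult_distrib)
  ultimately show ?thesis using num_accepted_le_opt[of \<omega> ?\<sigma> f] by simp
qed

text \<open>This is where being online enters: a decision depends only on earlier requests, so
  stopping early does not change the decisions already made.\<close>

lemma alg_take:
  assumes "n \<le> length \<sigma>"
  shows "alg A V (take n \<sigma>) = card {i \<in> {..<n}. run A V \<sigma> i \<noteq> None}"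
proof -
  have "{i. i < length (take n \<sigma>) \<and> run A V (take n \<sigma>) i \<noteq> None}
      = {i \<in> {..<n}. run A V \<sigma> i \<noteq> None}"
    using assms by (auto simp: run_def min_def)
  then show ?thesis by (simp add: alg_def num_accepted_def)
qed

text \<open>The centre comes first, so that its calls form a prefix. The leaves are every second one
  of its six neighbors, at angles 0, 120 and 240 degrees, hence pairwise non-adjacent.\<close>

definition star :: "cell list" where
  "star = [(0, 0), (1, 0), (-1, 1), (0, -1)]"

lemma triangle_free_star: "triangle_free (set star)"
  by (simp add: triangle_free_def star_def neighbor_def)

text \<open>Each leaf together with the centre accepts at most \<omega> calls. Summing over the
  three leaves counts the centre three times: once within the total for the whole star, and twice
  more in the first summand.\<close>

lemma star_game:
  assumes "online_algorithm \<omega> A"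
  defines "alg' \<equiv> alg A (set star)"
  shows "2 * alg' (flood \<omega> (take 1 star)) + alg' (flood \<omega> star) \<le> 3 * \<omega>"
proof -
  let ?\<sigma> = "flood \<omega> star"
  define f where "f = run A (set star) ?\<sigma>"
  define block where "block k = {k * \<omega>..<Suc k * \<omega>}" for k
  define acc where "acc k = {i \<in> block k. f i \<noteq> None}" for k
  have len: "length star = 4" by (simp add: star_def)
  have cf: "conflict_free \<omega> ?\<sigma> f"
    using assms(1) triangle_free_star set_flood[of \<omega> star]
    unfolding online_algorithm_def f_def by blast
  have fin: "finite (acc k)" for k by (simp add: acc_def block_def)
  have disj: "acc k \<inter> acc l = {}" if "k < l" for k l
  proof -
    have "Suc k * \<omega> \<le> l * \<omega>" using that by (intro mult_le_mono1) simp
    then show ?thesis by (auto simp: acc_def block_def)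
  qed
  have div: "i div \<omega> = k" if "i \<in> block k" for i k
    using that unfolding block_def by (intro div_nat_eqI) (auto simp: algebra_simps)
  have center_leaf: "card (acc 0) + card (acc k) \<le> \<omega>" if "k \<in> {1, 2, 3}" for k
  proof -
    have "card {i \<in> block 0 \<union> block k. f i \<noteq> None} \<le> \<omega>"
    proof (rule card_accepted_clique_le[OF cf])
      show sub: "block 0 \<union> block k \<subseteq> {..<length ?\<sigma>}"
        using that by (auto simp: block_def len)
      fix i j assume ij: "i \<in> block 0 \<union> block k" "j \<in> block 0 \<union> block k"
      have nth: "?\<sigma> ! i = star ! (i div \<omega>)" if "i \<in> block 0 \<union> block k" for i
        using that sub by (intro nth_flood) auto
      \<comment> \<open>The centre and one leaf form a clique of cells, so all requests of their two
        blocks conflict pairwise.\<close>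
      have "\<forall>a\<in>{0, k}. \<forall>b\<in>{0, k}. star ! a = star ! b \<or> neighbor (star ! a) (star ! b)"
        using that by (elim insertE emptyE) (simp_all add: star_def neighbor_def)
      moreover have "i div \<omega> \<in> {0, k}" "j div \<omega> \<in> {0, k}" using ij div by auto
      ultimately show "?\<sigma> ! i = ?\<sigma> ! j \<or> neighbor (?\<sigma> ! i) (?\<sigma> ! j)"
        unfolding nth[OF ij(1)] nth[OF ij(2)] by blast
    qed
    also have "{i \<in> block 0 \<union> block k. f i \<noteq> None} = acc 0 \<union> acc k"
      by (auto simp: acc_def)
    finally show ?thesis using card_Un_disjoint[OF fin fin disj[of 0 k]] that by auto
  qed
  have "flood \<omega> (take 1 star) = take \<omega> ?\<sigma>"
    using take_flood[of 1 star \<omega>] len by simp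
  then have first: "alg' (flood \<omega> (take 1 star)) = card (acc 0)"
    unfolding alg'_def
    by (simp add: alg_take len acc_def block_def f_def lessThan_atLeast0)
  have "alg' ?\<sigma> = card {i \<in> {..<4 * \<omega>}. f i \<noteq> None}"
    using alg_take[of "4 * \<omega>" ?\<sigma> A "set star"] by (simp add: alg'_def f_def len)
  also have "{i \<in> {..<4 * \<omega>}. f i \<noteq> None} = acc 0 \<union> acc 1 \<union> acc 2 \<union> acc 3"
    by (auto simp: acc_def block_def)
  also have "card \<dots> \<le> card (acc 0) + card (acc 1) + card (acc 2) + card (acc 3)"
    by (meson add_le_mono1 card_Un_le order_trans)
  finally show ?thesis
    using first center_leaf[of 1] center_leaf[of 2] center_leaf[of 3] by simp
qed

theorem theorem3:
  fixes \<omega> :: nat and A :: strategy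
  assumes "\<omega> > 0"
    and "online_algorithm \<omega> A"
  shows "(\<exists>V \<sigma>. triangle_free V \<and> set \<sigma> \<subseteq> V \<and> \<sigma> \<noteq> [] \<and>
            real (opt \<omega> \<sigma>) \<ge> 5 / 3 * real (alg A V \<sigma>)) \<and>
         competitive_ratio \<omega> A \<ge> ereal (5 / 3)"
proof -
  let ?V = "set star"
  define \<sigma>\<^sub>1 where "\<sigma>\<^sub>1 = flood \<omega> (take 1 star)"
  define \<sigma>\<^sub>2 where "\<sigma>\<^sub>2 = flood \<omega> star"
  have opt1: "\<omega> \<le> opt \<omega> \<sigma>\<^sub>1"
    using opt_flood_ge[of 0 "take 1 star" \<omega>] by (simp add: \<sigma>\<^sub>1_def star_def neighbor_def)
  have opt2: "3 * \<omega> \<le> opt \<omega> \<sigma>\<^sub>2"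
    using opt_flood_ge[of 1 star \<omega>] by (simp add: \<sigma>\<^sub>2_def star_def neighbor_def)
  have sub: "set \<sigma>\<^sub>1 \<subseteq> ?V" "set \<sigma>\<^sub>2 \<subseteq> ?V"
    using set_flood[of \<omega> "take 1 star"] set_flood[of \<omega> star] set_take_subset[of 1 star]
    unfolding \<sigma>\<^sub>1_def \<sigma>\<^sub>2_def by blast+
  have "length \<sigma>\<^sub>1 > 0" "length \<sigma>\<^sub>2 > 0"
    using assms(1) by (simp_all add: \<sigma>\<^sub>1_def \<sigma>\<^sub>2_def star_def)
  then have ne: "\<sigma>\<^sub>1 \<noteq> []" "\<sigma>\<^sub>2 \<noteq> []" by auto
  have "2 * alg A ?V \<sigma>\<^sub>1 + alg A ?V \<sigma>\<^sub>2 \<le> 3 * \<omega>"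
    using star_game[OF assms(2)] by (simp add: \<sigma>\<^sub>1_def \<sigma>\<^sub>2_def)
  \<comment> \<open>If both failed, the algorithm would accept more than 3 \<omega> / 5 calls on
    \<open>\<sigma>\<^sub>1\<close> and more than 9 \<omega> / 5 on \<open>\<sigma>\<^sub>2\<close>.
    Twice the first plus the second would then exceed 3 \<omega>; the ratio 5/3 is exactly what
    balances the two cases.\<close>
  then have "5 / 3 * real (alg A ?V \<sigma>\<^sub>1) \<le> real (opt \<omega> \<sigma>\<^sub>1) \<or>
      5 / 3 * real (alg A ?V \<sigma>\<^sub>2) \<le> real (opt \<omega> \<sigma>\<^sub>2)"
    using opt1 opt2 by linarith
  then obtain \<sigma> where \<sigma>: "set \<sigma> \<subseteq> ?V" "\<sigma> \<noteq> []"
      "5 / 3 * real (alg A ?V \<sigma>) \<le> real (opt \<omega> \<sigma>)"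
    using sub ne by blast
  then show ?thesis
    using triangle_free_star competitive_ratio_geI[OF triangle_free_star \<sigma>(1,2) assms(1) \<sigma>(3)]
    by blast
qed

end
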